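(* Let $W\in\mathbb N$ be the maximal window size, $\mathcal U$ the universe of elements and $\epsilon>0$, and assume $W\epsilon/12$ and $\epsilon^{-1}$ are integers. The algorithm RAW, instantiated with WCSS as its black-box fixed-window algorithm, uses $O(\epsilon^{-2}(\log W+\log|\mathcal U|))$ bits of memory, processes each ADD operation in $O(\epsilon^{-1})$ time, and answers each interval query in $O(1)$ time.
   Context: A stream is a sequence $x_1,x_2,\ldots$ of elements of a universe $\mathcal U$. For $x\in\mathcal U$ and $0\le w\le W$, $f_x^w$ denotes the number of occurrences of $x$ among the last $w$ elements of the stream, and for $i\le j\le W$, $f_x^{i,j}=f_x^j-f_x^i$. An interval query $(x,i,j)$ asks for an estimate of $f_x^{i,j}$. WCSS is a fixed-window frequency-estimation algorithm: an instance $\mathbb A(w,\epsilon')$ supports ADD$(x)$ (append $x$ to the stream) and Query$(x)$, which returns an estimate $\hat f$ with $f_x^w\le \hat f\le f_x^w+w\epsilon'$; it stores $O(1/\epsilon')$ counters, each consisting of an $O(\log|\mathcal U|)$-bit element identifier and an $O(\log w)$-bit value, and performs ADD and Query in $O(1)$ time. RAW maintains $4\epsilon^{-1}$ instances $A_1,\ldots,A_{4\epsilon^{-1}}$, where $A_\ell$ is a WCSS instance $\mathbb A(\ell\cdot W\epsilon/4,\ \epsilon/4)$. ADD$(x)$ invokes $A_\ell$.ADD$(x)$ for every $\ell=1,\ldots,4\epsilon^{-1}$. An interval query $(x,i,j)$ returns $A_{\lceil j/(W\epsilon/4)\rceil}.\mathrm{Query}(x)-A_{\lfloor i/(W\epsilon/4)\rfloor}.\mathrm{Query}(x)+W\epsilon/4$.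 *)

theory Defs
  imports Complex_Main "HOL-Library.Monad_Syntax" "HOL-Library.Log_Nat"
begin

text \<open>
  Cost model: a computation returns its result together with the number of RAM steps it takes.
  Arithmetic, tests, loop control and loads of program constants (\<open>step\<close>) and accesses to one
  cell of an array of data structures cost one step each; sequential composition adds the costs.
\<close>

datatype 'a tm = TM (val: 'a) (time: nat)

definition tm_bind :: "'a tm \<Rightarrow> ('a \<Rightarrow> 'b tm) \<Rightarrow> 'b tm" where
  "tm_bind m f = TM (val (f (val m))) (time m + time (f (val m)))"

adhoc_overloading Monad_Syntax.bind \<rightleftharpoons> tm_bind

definition step :: "'a \<Rightarrow> 'a tm" where
  "step v = TM v 1"

definition array_get :: "'a list \<Rightarrow> nat \<Rightarrow> 'a tm" where
  "array_get S k = TM (S ! k) 1"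

definition array_set :: "'a list \<Rightarrow> nat \<Rightarrow> 'a \<Rightarrow> 'a list tm" where
  "array_set S k v = TM (S[k := v]) 1"

text \<open>
  Streams are lists in order of arrival. If fewer than \<open>w\<close> elements have arrived, the last \<open>w\<close>
  elements are all of them.
\<close>

definition freq :: "'u list \<Rightarrow> nat \<Rightarrow> 'u \<Rightarrow> nat" where
  "freq xs w x = count_list (drop (length xs - w) xs) x"

text \<open>
  The memory of a fixed-window algorithm is a list of counters, each consisting of the bits of an
  identifier and the bits of a value. There is no other persistent state, so the size of this list
  measures all the memory an instance uses. The three operations take the universe, the window
  size and the accuracy of the instance as their first arguments.
\<close>

type_synonym counter = "bool list \<times> bool list"

type_synonym fw_state = "counter list"

record 'u fw_alg =
  fw_init :: "'u set \<Rightarrow> nat \<Rightarrow> real \<Rightarrow> fw_state"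
  fw_add :: "'u set \<Rightarrow> nat \<Rightarrow> real \<Rightarrow> 'u \<Rightarrow> fw_state \<Rightarrow> fw_state tm"
  fw_query :: "'u set \<Rightarrow> nat \<Rightarrow> real \<Rightarrow> 'u \<Rightarrow> fw_state \<Rightarrow> real tm"

definition fw_bits :: "fw_state \<Rightarrow> nat" where
  "fw_bits s = (\<Sum>c\<leftarrow>s. length (fst c) + length (snd c))"

definition fw_run :: "'u fw_alg \<Rightarrow> 'u set \<Rightarrow> nat \<Rightarrow> real \<Rightarrow> 'u list \<Rightarrow> fw_state" where
  "fw_run A U w \<epsilon>' xs = foldl (\<lambda>s x. val (fw_add A U w \<epsilon>' x s)) (fw_init A U w \<epsilon>') xs"

definition fw_instance :: "'u set \<Rightarrow> nat \<Rightarrow> real \<Rightarrow> bool" where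
  "fw_instance U w \<epsilon>' \<longleftrightarrow> finite U \<and> U \<noteq> {} \<and> w \<ge> 1 \<and> 0 < \<epsilon>' \<and> \<epsilon>' \<le> 1"

text \<open>
  The guarantees of WCSS. The constants are uniform in the universe, the window size, the accuracy
  and the stream. The summand 1 in the bounds on the two fields of a counter only matters when
  \<open>card U = 1\<close> or \<open>w = 1\<close>, where the logarithm vanishes.
\<close>

definition fw_accurate :: "'u fw_alg \<Rightarrow> bool" where
  "fw_accurate A \<longleftrightarrow> (\<forall>U w \<epsilon>' xs x. fw_instance U w \<epsilon>' \<longrightarrow> xs \<in> lists U \<longrightarrow> x \<in> U \<longrightarrow>
     (let est = val (fw_query A U w \<epsilon>' x (fw_run A U w \<epsilon>' xs))
      in real (freq xs w x) \<le> est \<and> est \<le> real (freq xs w x) + real w * \<epsilon>'))"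

definition fw_counter_bound :: "'u fw_alg \<Rightarrow> bool" where
  "fw_counter_bound A \<longleftrightarrow> (\<exists>c>0. \<forall>U w \<epsilon>' xs. fw_instance U w \<epsilon>' \<longrightarrow> xs \<in> lists U \<longrightarrow>
     real (length (fw_run A U w \<epsilon>' xs)) \<le> c * (1 / \<epsilon>') \<and>
     (\<forall>(ident, value) \<in> set (fw_run A U w \<epsilon>' xs).
        real (length ident) \<le> c * (1 + log 2 (real (card U))) \<and>
        real (length value) \<le> c * (1 + log 2 (real w))))"

definition fw_constant_time :: "'u fw_alg \<Rightarrow> bool" where
  "fw_constant_time A \<longleftrightarrow> (\<exists>c. \<forall>U w \<epsilon>' xs x. fw_instance U w \<epsilon>' \<longrightarrow> xs \<in> lists U \<longrightarrow> x \<in> U \<longrightarrow>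
     time (fw_add A U w \<epsilon>' x (fw_run A U w \<epsilon>' xs)) \<le> c \<and>
     time (fw_query A U w \<epsilon>' x (fw_run A U w \<epsilon>' xs)) \<le> c)"

definition is_WCSS :: "'u fw_alg \<Rightarrow> bool" where
  "is_WCSS A \<longleftrightarrow> fw_accurate A \<and> fw_counter_bound A \<and> fw_constant_time A"

text \<open>
  RAW. Its state is the array of the instances \<open>A\<^sub>1, \<dots>, A\<^sub>n\<close> with \<open>n = 4 / \<epsilon>\<close>; the instance \<open>A\<^sub>l\<close>
  is in cell \<open>l - 1\<close> and has window size \<open>l * b\<close> with \<open>b = W * \<epsilon> / 4\<close>.
  The floors below only convert types, as the two lemmas after \<open>raw_params\<close> show.
\<close>

type_synonym raw_state = "fw_state list"

definition raw_num :: "real \<Rightarrow> nat" where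
  "raw_num \<epsilon> = nat \<lfloor>4 / \<epsilon>\<rfloor>"

definition raw_block :: "nat \<Rightarrow> real \<Rightarrow> nat" where
  "raw_block W \<epsilon> = nat \<lfloor>real W * \<epsilon> / 4\<rfloor>"

definition raw_params :: "'u set \<Rightarrow> nat \<Rightarrow> real \<Rightarrow> bool" where
  "raw_params U W \<epsilon> \<longleftrightarrow> finite U \<and> U \<noteq> {} \<and> W \<ge> 1 \<and> \<epsilon> > 0 \<and>
     real W * \<epsilon> / 12 \<in> \<int> \<and> 1 / \<epsilon> \<in> \<int>"

lemma raw_num_exact:
  assumes "raw_params U W \<epsilon>"
  shows "real (raw_num \<epsilon>) = 4 / \<epsilon>"
proof -
  obtain k :: int where k: "1 / \<epsilon> = of_int k"
    using assms by (auto simp: raw_params_def elim: Ints_cases)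
  have "4 / \<epsilon> = of_int (4 * k)" using k by simp
  moreover have "4 / \<epsilon> > 0" using assms by (simp add: raw_params_def)
  ultimately show ?thesis by (simp add: raw_num_def del: of_int_mult)
qed

lemma raw_block_exact:
  assumes "raw_params U W \<epsilon>"
  shows "real (raw_block W \<epsilon>) = real W * \<epsilon> / 4"
proof -
  obtain k :: int where k: "real W * \<epsilon> / 12 = of_int k"
    using assms by (auto simp: raw_params_def elim: Ints_cases)
  have "real W * \<epsilon> / 4 = of_int (3 * k)" using k by simp
  moreover have "real W * \<epsilon> / 4 > 0" using assms by (simp add: raw_params_def)
  ultimately show ?thesis by (simp add: raw_block_def del: of_int_mult)
qed

definition raw_init :: "'u fw_alg \<Rightarrow> 'u set \<Rightarrow> nat \<Rightarrow> real \<Rightarrow> raw_state" where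
  "raw_init A U W \<epsilon> = map (\<lambda>l. fw_init A U (l * raw_block W \<epsilon>) (\<epsilon> / 4)) [1..<Suc (raw_num \<epsilon>)]"

text \<open>\<open>raw_add_upto A U W \<epsilon> x m\<close> invokes ADD on the instances \<open>A\<^sub>1, \<dots>, A\<^sub>m\<close>.\<close>

primrec raw_add_upto ::
    "'u fw_alg \<Rightarrow> 'u set \<Rightarrow> nat \<Rightarrow> real \<Rightarrow> 'u \<Rightarrow> nat \<Rightarrow> raw_state \<Rightarrow> raw_state tm" where
  "raw_add_upto A U W \<epsilon> x 0 S = step S"
| "raw_add_upto A U W \<epsilon> x (Suc m) S = do {
     S' \<leftarrow> raw_add_upto A U W \<epsilon> x m S;
     l \<leftarrow> step (Suc m);
     w \<leftarrow> step (l * raw_block W \<epsilon>);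
     s \<leftarrow> array_get S' (l - 1);
     s' \<leftarrow> fw_add A U w (\<epsilon> / 4) x s;
     array_set S' (l - 1) s'
   }"

definition raw_add ::
    "'u fw_alg \<Rightarrow> 'u set \<Rightarrow> nat \<Rightarrow> real \<Rightarrow> 'u \<Rightarrow> raw_state \<Rightarrow> raw_state tm" where
  "raw_add A U W \<epsilon> x S = do {
     n \<leftarrow> step (raw_num \<epsilon>);
     raw_add_upto A U W \<epsilon> x n S
   }"

definition raw_run :: "'u fw_alg \<Rightarrow> 'u set \<Rightarrow> nat \<Rightarrow> real \<Rightarrow> 'u list \<Rightarrow> raw_state" where
  "raw_run A U W \<epsilon> xs = foldl (\<lambda>S x. val (raw_add A U W \<epsilon> x S)) (raw_init A U W \<epsilon>) xs"

text \<open>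
  An interval query with \<open>i < b\<close> refers to \<open>A\<^sub>0\<close>, which is not among the stored instances. It stands
  for the empty window, on which every frequency is 0.
\<close>

definition raw_query_instance ::
    "'u fw_alg \<Rightarrow> 'u set \<Rightarrow> nat \<Rightarrow> real \<Rightarrow> 'u \<Rightarrow> nat \<Rightarrow> raw_state \<Rightarrow> real tm" where
  "raw_query_instance A U W \<epsilon> x l S = do {
     z \<leftarrow> step (l = 0);
     if z then step 0
     else do {
       w \<leftarrow> step (l * raw_block W \<epsilon>);
       s \<leftarrow> array_get S (l - 1);
       fw_query A U w (\<epsilon> / 4) x s
     }
   }"

definition raw_query ::
    "'u fw_alg \<Rightarrow> 'u set \<Rightarrow> nat \<Rightarrow> real \<Rightarrow> 'u \<Rightarrow> nat \<Rightarrow> nat \<Rightarrow> raw_state \<Rightarrow> real tm" where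
  "raw_query A U W \<epsilon> x i j S = do {
     b \<leftarrow> step (raw_block W \<epsilon>);
     hi \<leftarrow> step (nat \<lceil>real j / real b\<rceil>);
     lo \<leftarrow> step (nat \<lfloor>real i / real b\<rfloor>);
     fhi \<leftarrow> raw_query_instance A U W \<epsilon> x hi S;
     flo \<leftarrow> raw_query_instance A U W \<epsilon> x lo S;
     d \<leftarrow> step (fhi - flo);
     step (d + real b)
   }"

text \<open>
  Besides the instances, RAW stores the numbers \<open>n\<close> and \<open>b\<close> in binary; \<open>floorlog 2 k\<close> is the
  number of binary digits of \<open>k\<close>.
\<close>

definition raw_bits :: "nat \<Rightarrow> real \<Rightarrow> raw_state \<Rightarrow> nat" where
  "raw_bits W \<epsilon> S =
     (\<Sum>s\<leftarrow>S. fw_bits s) + floorlog 2 (raw_num \<epsilon>) + floorlog 2 (raw_block W \<epsilon>)"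

end

theory Submission
  imports Defs
begin

text \<open>
  Cell \<open>l - 1\<close> of RAW always holds the state that WCSS with window \<open>l * b\<close> reaches on the same
  stream, and \<open>l * b \<le> n * b = W\<close>. The bounds follow by adding up the bounds of \<open>n = 4 / \<epsilon>\<close>
  instances, each with \<open>O(1 / \<epsilon>)\<close> counters. Integrality of \<open>W * \<epsilon> / 12\<close> and \<open>1 / \<epsilon>\<close> forces
  \<open>\<epsilon> \<le> 1\<close> and \<open>W \<ge> 12\<close>; hence \<open>log 2 W \<ge> 1\<close> absorbs all additive constants.
\<close>

lemma Ints_pos_ge_1: "1 \<le> x" if "x \<in> \<int>" "0 < x" for x :: real
  using that by (auto elim!: Ints_cases)

text \<open>A positive integer is at least 1. Applied to \<open>1 / \<epsilon>\<close> this gives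
  \<open>\<epsilon> \<le> 1\<close>, and applied to \<open>W * \<epsilon> / 12\<close> it gives
  \<open>W \<ge> 12\<close>; only \<open>W \<ge> 2\<close> is recorded, which is what
  \<open>log 2 W \<ge> 1\<close> requires. The last claim is
  \<open>(4 / \<epsilon>) * (W * \<epsilon> / 4) = W\<close>, read off in the reals and cast
  back.\<close>

lemma raw_params_bounds:
  assumes "raw_params U W \<epsilon>"
  shows raw_params_eps: "0 < \<epsilon>" "\<epsilon> \<le> 1"
    and raw_params_window: "W \<ge> 2"
    and raw_num_pos: "0 < raw_num \<epsilon>"
    and raw_block_pos: "0 < raw_block W \<epsilon>"
    and raw_num_times_block: "raw_num \<epsilon> * raw_block W \<epsilon> = W"
proof -
  have pos: "0 < \<epsilon>" "0 < real W" using assms by (auto simp: raw_params_def)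
  have "1 \<le> 1 / \<epsilon>" using assms pos by (intro Ints_pos_ge_1) (auto simp: raw_params_def)
  with pos show le: "0 < \<epsilon>" "\<epsilon> \<le> 1" by (auto simp: field_simps)
  have "1 \<le> real W * \<epsilon> / 12" using assms pos by (intro Ints_pos_ge_1) (auto simp: raw_params_def)
  moreover have "real W * \<epsilon> \<le> real W * 1" using le by (intro mult_left_mono) auto
  ultimately show "W \<ge> 2" by linarith
  have "0 < real (raw_num \<epsilon>)" "0 < real (raw_block W \<epsilon>)"
    using pos by (simp_all add: raw_num_exact[OF assms] raw_block_exact[OF assms])
  then show "0 < raw_num \<epsilon>" "0 < raw_block W \<epsilon>" by simp_all
  have "real (raw_num \<epsilon> * raw_block W \<epsilon>) = real W"
    using pos by (simp add: raw_num_exact[OF assms] raw_block_exact[OF assms])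
  then show "raw_num \<epsilon> * raw_block W \<epsilon> = W" by (simp only: of_nat_eq_iff)
qed

lemma fw_instance_raw:
  assumes "raw_params U W \<epsilon>" "0 < l"
  shows "fw_instance U (l * raw_block W \<epsilon>) (\<epsilon> / 4)"
  using assms raw_params_bounds[OF assms(1)]
  by (auto simp: fw_instance_def raw_params_def Suc_le_eq)

lemma fw_run_Nil [simp]: "fw_run A U w \<epsilon>' [] = fw_init A U w \<epsilon>'"
  by (simp add: fw_run_def)

lemma fw_run_snoc [simp]:
  "fw_run A U w \<epsilon>' (xs @ [x]) = val (fw_add A U w \<epsilon>' x (fw_run A U w \<epsilon>' xs))"
  by (simp add: fw_run_def)

lemma length_raw_add_upto [simp]:
  "length (val (raw_add_upto A U W \<epsilon> x m S)) = length S"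
  by (induction m) (simp_all add: tm_bind_def step_def array_get_def array_set_def)

text \<open>Cell \<open>k\<close> is written only in the iteration for the instance with index
  \<open>Suc k\<close>, so that iteration still finds the original content
  \<open>S ! k\<close>.\<close>

lemma nth_raw_add_upto:
  assumes "k < length S"
  shows "val (raw_add_upto A U W \<epsilon> x m S) ! k =
    (if k < m then val (fw_add A U (Suc k * raw_block W \<epsilon>) (\<epsilon> / 4) x (S ! k)) else S ! k)"
  using assms
  by (induction m)
    (auto simp: tm_bind_def step_def array_get_def array_set_def nth_list_update less_Suc_eq)

text \<open>The instances never interact, so running the array equals running each instance on its
  own. Both runs are left folds, hence the induction appends elements at the right end. This
  transfers every guarantee about \<open>fw_run\<close> to the cells of RAW.\<close>

lemma raw_run_eq:
  "raw_run A U W \<epsilon> xs =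
    map (\<lambda>l. fw_run A U (l * raw_block W \<epsilon>) (\<epsilon> / 4) xs) [1..<Suc (raw_num \<epsilon>)]"
proof (induction xs rule: rev_induct)
  case Nil
  then show ?case by (simp add: raw_run_def raw_init_def)
next
  case (snoc x xs)
  have "raw_run A U W \<epsilon> (xs @ [x]) =
      val (raw_add_upto A U W \<epsilon> x (raw_num \<epsilon>) (raw_run A U W \<epsilon> xs))"
    by (simp add: raw_run_def raw_add_def tm_bind_def step_def)
  then show ?case
    unfolding snoc.IH
    \<comment> \<open>Deleting \<open>upt_Suc\<close> keeps \<open>[1..<Suc n]\<close> intact for
      the rules on length and indexing.\<close>
    by (auto intro!: nth_equalityI simp: nth_raw_add_upto simp del: upt_Suc)
qed

lemma length_raw_run [simp]: "length (raw_run A U W \<epsilon> xs) = raw_num \<epsilon>"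
  by (simp add: raw_run_eq del: upt_Suc)

lemma nth_raw_run:
  "k < raw_num \<epsilon> \<Longrightarrow>
    raw_run A U W \<epsilon> xs ! k = fw_run A U (Suc k * raw_block W \<epsilon>) (\<epsilon> / 4) xs"
  by (simp add: raw_run_eq del: upt_Suc)

text \<open>Each iteration costs two \<open>step\<close>s, one read, one write and one ADD of cost
  at most \<open>c\<close>; the leading 1 is the base case. Bounding ADD on the initial array
  suffices, since the first \<open>m\<close> iterations leave cell \<open>m\<close>
  untouched.\<close>

lemma time_raw_add_upto:
  assumes "m \<le> length S"
    and "\<And>k. k < m \<Longrightarrow> time (fw_add A U (Suc k * raw_block W \<epsilon>) (\<epsilon> / 4) x (S ! k)) \<le> c"
  shows "time (raw_add_upto A U W \<epsilon> x m S) \<le> 1 + m * (4 + c)"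
  using assms
proof (induction m)
  case 0
  then show ?case by (simp add: step_def)
next
  case (Suc m)
  have "time (raw_add_upto A U W \<epsilon> x m S) \<le> 1 + m * (4 + c)"
    using Suc by simp
  moreover have "time (fw_add A U (Suc m * raw_block W \<epsilon>) (\<epsilon> / 4) x (S ! m)) \<le> c"
    using Suc.prems(2) by blast
  ultimately show ?case
    using Suc.prems(1)
    by (simp add: tm_bind_def step_def array_get_def array_set_def nth_raw_add_upto)
qed

text \<open>The 3 counts the test, the window size and the array access; the branch for
  \<open>l = 0\<close> costs only 2.\<close>

lemma time_raw_query_instance:
  assumes "0 < l \<Longrightarrow> time (fw_query A U (l * raw_block W \<epsilon>) (\<epsilon> / 4) x (S ! (l - 1))) \<le> c"
  shows "time (raw_query_instance A U W \<epsilon> x l S) \<le> 3 + c"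
  using assms
  by (auto simp: raw_query_instance_def tm_bind_def step_def array_get_def)

text \<open>One factor \<open>c\<close> comes from the number of counters, the other from the size
  of a counter, whose two fields contribute the summand 2.\<close>

lemma fw_bits_run_le:
  assumes c: "0 < c"
    and len: "real (length s) \<le> c * (1 / \<epsilon>')"
    and fields: "\<forall>(ident, value) \<in> set s.
      real (length ident) \<le> c * (1 + log 2 u) \<and> real (length value) \<le> c * (1 + log 2 w)"
    and "1 \<le> u" "1 \<le> w"
  shows "real (fw_bits s) \<le> c\<^sup>2 * (1 / \<epsilon>') * (2 + log 2 u + log 2 w)"
proof -
  let ?B = "c * (2 + log 2 u + log 2 w)"
  have "real (fw_bits s) = (\<Sum>p\<leftarrow>s. real (length (fst p) + length (snd p)))"
    by (simp add: fw_bits_def sum_list_of_nat[symmetric] comp_def)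
  also have "\<dots> \<le> (\<Sum>p\<leftarrow>s. ?B)"
    using fields by (intro sum_list_mono) (fastforce simp: algebra_simps)
  also have "\<dots> = real (length s) * ?B"
    by (simp add: sum_list_triv)
  also have "\<dots> \<le> (c * (1 / \<epsilon>')) * ?B"
    using assms by (intro mult_right_mono[OF len]) auto
  finally show ?thesis by (simp add: power2_eq_square mult_ac)
qed

lemma raw_bits_bound:
  assumes "fw_counter_bound A"
  shows "\<exists>C. \<forall>U W \<epsilon> xs. raw_params U W \<epsilon> \<longrightarrow> xs \<in> lists U \<longrightarrow>
    real (raw_bits W \<epsilon> (raw_run A U W \<epsilon> xs))
      \<le> C * ((1 / \<epsilon>)\<^sup>2 * (log 2 (real W) + log 2 (real (card U))))"
proof -
  obtain c where c: "0 < c" and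
    bound: "\<And>U w \<epsilon>' xs. fw_instance U w \<epsilon>' \<Longrightarrow> xs \<in> lists U \<Longrightarrow>
     real (length (fw_run A U w \<epsilon>' xs)) \<le> c * (1 / \<epsilon>') \<and>
     (\<forall>(ident, value) \<in> set (fw_run A U w \<epsilon>' xs).
        real (length ident) \<le> c * (1 + log 2 (real (card U))) \<and>
        real (length value) \<le> c * (1 + log 2 (real w)))"
    using assms unfolding fw_counter_bound_def by blast
  show ?thesis
  \<comment> \<open>\<open>48 = 4 * 4 * 3\<close>: there are \<open>4 / \<epsilon>\<close>
    instances, each of accuracy \<open>\<epsilon> / 4\<close>, and the factor 3 absorbs the additive
    2 into the logarithms. The 4 pays for the two stored numbers, 2 for each.\<close>
  proof (intro exI[of _ "48 * c\<^sup>2 + 4"] allI impI)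
    fix U :: "'a set" and W :: nat and \<epsilon> :: real and xs
    assume par: "raw_params U W \<epsilon>" and xs: "xs \<in> lists U"
    note bnds = raw_params_bounds[OF par]
    define L where "L = log 2 (real W) + log 2 (real (card U))"
    have card: "1 \<le> real (card U)"
      using par by (simp add: raw_params_def Suc_le_eq card_gt_0_iff)
    have logW: "1 \<le> log 2 (real W)" using bnds(3) by (simp add: le_log_iff)
    have logU: "0 \<le> log 2 (real (card U))" using card by simp
    have inst: "real (fw_bits s) \<le> 12 * c\<^sup>2 * (1 / \<epsilon>) * L"
      if "s \<in> set (raw_run A U W \<epsilon> xs)" for s
    proof -
      obtain l where "l \<in> {1..<Suc (raw_num \<epsilon>)}"
        and s: "s = fw_run A U (l * raw_block W \<epsilon>) (\<epsilon> / 4) xs"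
        using \<open>s \<in> _\<close> unfolding raw_run_eq set_map set_upt by (rule imageE)
      then have l: "0 < l" "l \<le> raw_num \<epsilon>" by auto
      let ?w = "l * raw_block W \<epsilon>"
      have w: "1 \<le> ?w" using l bnds(5) by (simp add: Suc_le_eq)
      have "?w \<le> W" using mult_le_mono1[OF l(2)] bnds(6) by metis
      then have "real ?w \<le> real W" by (simp only: of_nat_le_iff)
      moreover have w1: "1 \<le> real ?w" using w by (metis of_nat_1 of_nat_mono)
      ultimately have "log 2 (real ?w) \<le> log 2 (real W)"
        by (intro log_mono) auto
      \<comment> \<open>The 2 is at most \<open>2 * log 2 W\<close>, and the logarithm of the window
        adds at most one more \<open>log 2 W\<close>.\<close>
      then have sum_logs: "2 + log 2 (real (card U)) + log 2 (real ?w) \<le> 3 * L"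
        using logW logU by (simp add: L_def)
      have "real (fw_bits s)
          \<le> c\<^sup>2 * (1 / (\<epsilon> / 4)) * (2 + log 2 (real (card U)) + log 2 (real ?w))"
        using bound[OF fw_instance_raw[OF par l(1)] xs] card w1 unfolding s
        by (intro fw_bits_run_le[OF c]) auto
      also have "\<dots> \<le> c\<^sup>2 * (1 / (\<epsilon> / 4)) * (3 * L)"
        using bnds(1) by (intro mult_left_mono[OF sum_logs]) auto
      finally show ?thesis by (simp add: mult_ac)
    qed
    have "real (\<Sum>s\<leftarrow>raw_run A U W \<epsilon> xs. fw_bits s)
        = (\<Sum>s\<leftarrow>raw_run A U W \<epsilon> xs. real (fw_bits s))"
      by (simp add: sum_list_of_nat[symmetric] comp_def)
    also have "\<dots> \<le> (\<Sum>s\<leftarrow>raw_run A U W \<epsilon> xs. 12 * c\<^sup>2 * (1 / \<epsilon>) * L)"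
      by (intro sum_list_mono inst)
    also have "\<dots> = 48 * c\<^sup>2 * ((1 / \<epsilon>)\<^sup>2 * L)"
      by (simp add: sum_list_triv raw_num_exact[OF par] power2_eq_square)
    finally have inst_sum: "real (\<Sum>s\<leftarrow>raw_run A U W \<epsilon> xs. fw_bits s) \<le> 48 * c\<^sup>2 * ((1 / \<epsilon>)\<^sup>2 * L)" .
    \<comment> \<open>The number of digits is at most \<open>log 2 k + 1 \<le> 2 * log 2 W\<close>,
      and \<open>1 / \<epsilon> \<ge> 1\<close> allows the factor
      \<open>(1 / \<epsilon>)\<^sup>2\<close>. Divisibility is a condition that \<open>n\<close> and
      \<open>b\<close> share because \<open>n * b = W\<close>.\<close>
    have digits: "real (floorlog 2 k) \<le> 2 * ((1 / \<epsilon>)\<^sup>2 * L)" if "0 < k" "k dvd W" for k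
    proof -
      have "k \<le> W" using that bnds(3) by (auto intro: dvd_imp_le)
      then have "log 2 (real k) \<le> log 2 (real W)" "0 \<le> log 2 (real k)"
        using that by auto
      then have "real (floorlog 2 k) \<le> 2 * (1 * L)"
        using that logW logU by (simp add: floorlog_def L_def) linarith
      also have "\<dots> \<le> 2 * ((1 / \<epsilon>)\<^sup>2 * L)"
        using logW logU bnds(1,2)
        by (intro mult_left_mono mult_right_mono one_le_power) (auto simp: L_def)
      finally show ?thesis .
    qed
    have "raw_num \<epsilon> dvd W" "raw_block W \<epsilon> dvd W"
      using bnds(6) by (metis dvd_triv_left, metis dvd_triv_right)
    then show "real (raw_bits W \<epsilon> (raw_run A U W \<epsilon> xs)) \<le>
        (48 * c\<^sup>2 + 4) * ((1 / \<epsilon>)\<^sup>2 * (log 2 (real W) + log 2 (real (card U))))"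
      using inst_sum digits[of "raw_num \<epsilon>"] digits[of "raw_block W \<epsilon>"] bnds(4,5)
      unfolding raw_bits_def L_def[symmetric] by (simp add: distrib_right)
  qed
qed

lemma raw_add_time_bound:
  assumes "fw_constant_time A"
  shows "\<exists>C. \<forall>U W \<epsilon> xs x. raw_params U W \<epsilon> \<longrightarrow> xs \<in> lists U \<longrightarrow> x \<in> U \<longrightarrow>
    real (time (raw_add A U W \<epsilon> x (raw_run A U W \<epsilon> xs))) \<le> C * (1 / \<epsilon>)"
proof -
  obtain c where c: "\<And>U w \<epsilon>' xs x. fw_instance U w \<epsilon>' \<Longrightarrow> xs \<in> lists U \<Longrightarrow> x \<in> U \<Longrightarrow>
     time (fw_add A U w \<epsilon>' x (fw_run A U w \<epsilon>' xs)) \<le> c"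
    using assms unfolding fw_constant_time_def by blast
  show ?thesis
  \<comment> \<open>The loop over \<open>4 / \<epsilon>\<close> instances at \<open>4 + c\<close>
    each gives \<open>16 + 4 * c\<close>; loading \<open>n\<close> and the base case of the loop
    cost 2, absorbed by \<open>1 / \<epsilon> \<ge> 1\<close>.\<close>
  proof (intro exI[of _ "18 + 4 * real c"] allI impI)
    fix U :: "'a set" and W :: nat and \<epsilon> :: real and xs x
    assume par: "raw_params U W \<epsilon>" and xs: "xs \<in> lists U" "x \<in> U"
    have "time (raw_add_upto A U W \<epsilon> x (raw_num \<epsilon>) (raw_run A U W \<epsilon> xs))
        \<le> 1 + raw_num \<epsilon> * (4 + c)"
      by (rule time_raw_add_upto)
        (simp_all add: nth_raw_run c[OF fw_instance_raw[OF par] xs] del: mult_Suc)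
    then have "time (raw_add A U W \<epsilon> x (raw_run A U W \<epsilon> xs)) \<le> 2 + raw_num \<epsilon> * (4 + c)"
      by (simp add: raw_add_def tm_bind_def step_def)
    then have "real (time (raw_add A U W \<epsilon> x (raw_run A U W \<epsilon> xs)))
        \<le> real (2 + raw_num \<epsilon> * (4 + c))"
      by (simp only: of_nat_le_iff)
    also have "\<dots> = 2 + (16 + 4 * real c) * (1 / \<epsilon>)"
      by (simp add: raw_num_exact[OF par] algebra_simps add_divide_distrib)
    also have "\<dots> \<le> 2 * (1 / \<epsilon>) + (16 + 4 * real c) * (1 / \<epsilon>)"
      using raw_params_eps[OF par] by (simp add: pos_le_divide_eq)
    finally show "real (time (raw_add A U W \<epsilon> x (raw_run A U W \<epsilon> xs)))
        \<le> (18 + 4 * real c) * (1 / \<epsilon>)"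
      by (simp add: add_divide_distrib)
  qed
qed

lemma raw_query_time_bound:
  assumes "fw_constant_time A"
  shows "\<exists>C. \<forall>U W \<epsilon> xs x i j. raw_params U W \<epsilon> \<longrightarrow> xs \<in> lists U \<longrightarrow> x \<in> U \<longrightarrow>
    i \<le> j \<longrightarrow> j \<le> W \<longrightarrow>
    real (time (raw_query A U W \<epsilon> x i j (raw_run A U W \<epsilon> xs))) \<le> C"
proof -
  obtain c where c: "\<And>U w \<epsilon>' xs x. fw_instance U w \<epsilon>' \<Longrightarrow> xs \<in> lists U \<Longrightarrow> x \<in> U \<Longrightarrow>
     time (fw_query A U w \<epsilon>' x (fw_run A U w \<epsilon>' xs)) \<le> c"
    using assms unfolding fw_constant_time_def by blast
  show ?thesis
  \<comment> \<open>Five own steps of the query plus two instance queries at \<open>3 + c\<close>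
    each.\<close>
  proof (intro exI[of _ "real (11 + 2 * c)"] allI impI)
    fix U :: "'a set" and W :: nat and \<epsilon> :: real and xs x i j
    assume par: "raw_params U W \<epsilon>" and xs: "xs \<in> lists U" "x \<in> U" and ij: "i \<le> j" "j \<le> W"
    let ?b = "raw_block W \<epsilon>" and ?n = "raw_num \<epsilon>" and ?S = "raw_run A U W \<epsilon> xs"
    have b: "0 < real ?b" using raw_block_pos[OF par] by simp
    have nb: "real ?n * real ?b = real W"
      using raw_num_times_block[OF par] by (metis of_nat_mult)
    \<comment> \<open>Since \<open>n * b = W\<close>, the bound \<open>j \<le> W\<close> keeps both
      indices within the stored array. Rounding \<open>j / b\<close> up cannot exceed
      \<open>n\<close>, which is an integer.\<close>
    have idx: "real k / real ?b \<le> real ?n" if "k \<le> W" for k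
      using that b nb by (simp add: pos_divide_le_eq)
    have inst: "time (raw_query_instance A U W \<epsilon> x l ?S) \<le> 3 + c" if "l \<le> ?n" for l
    proof (rule time_raw_query_instance)
      assume "0 < l"
      with that show "time (fw_query A U (l * ?b) (\<epsilon> / 4) x (?S ! (l - 1))) \<le> c"
        using c[OF fw_instance_raw[OF par, of l] xs] by (simp add: nth_raw_run del: mult_Suc)
    qed
    have hi: "nat \<lceil>real j / real ?b\<rceil> \<le> ?n"
      using idx[OF ij(2)] by (simp add: ceiling_le_iff)
    have lo: "nat \<lfloor>real i / real ?b\<rfloor> \<le> ?n"
      using idx[of i] ij by linarith
    have "time (raw_query A U W \<epsilon> x i j ?S) \<le> 11 + 2 * c"
      using inst[OF hi] inst[OF lo] by (simp add: raw_query_def tm_bind_def step_def)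
    then show "real (time (raw_query A U W \<epsilon> x i j ?S)) \<le> real (11 + 2 * c)"
      by (simp only: of_nat_le_iff)
  qed
qed

theorem theorem1:
  fixes A :: "'u fw_alg"
  assumes "is_WCSS A"
  shows
    "(\<exists>C. \<forall>(U :: 'u set) (W :: nat) (\<epsilon> :: real) xs.
        raw_params U W \<epsilon> \<longrightarrow> xs \<in> lists U \<longrightarrow>
        real (raw_bits W \<epsilon> (raw_run A U W \<epsilon> xs))
          \<le> C * ((1 / \<epsilon>)\<^sup>2 * (log 2 (real W) + log 2 (real (card U))))) \<and>
     (\<exists>C. \<forall>(U :: 'u set) (W :: nat) (\<epsilon> :: real) xs x.
        raw_params U W \<epsilon> \<longrightarrow> xs \<in> lists U \<longrightarrow> x \<in> U \<longrightarrow>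
        real (time (raw_add A U W \<epsilon> x (raw_run A U W \<epsilon> xs))) \<le> C * (1 / \<epsilon>)) \<and>
     (\<exists>C. \<forall>(U :: 'u set) (W :: nat) (\<epsilon> :: real) xs x i j.
        raw_params U W \<epsilon> \<longrightarrow> xs \<in> lists U \<longrightarrow> x \<in> U \<longrightarrow> i \<le> j \<longrightarrow> j \<le> W \<longrightarrow>
        real (time (raw_query A U W \<epsilon> x i j (raw_run A U W \<epsilon> xs))) \<le> C)"
  using assms raw_bits_bound[of A] raw_add_time_bound[of A] raw_query_time_bound[of A]
  unfolding is_WCSS_def by blast

end
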